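(* Let $\Gamma$ be a graph on vertex set $X$ (possibly infinite), with graph semigroup $S_\Gamma$. (i) If $\Gamma=K_X$, then $\mathscr C(S_\Gamma)\cong\operatorname{Sym}(X)$. (ii) If $\Gamma\neq K_X$, then $\mathscr C(S_\Gamma)\cong\mathbb Z_2\times\mathscr C(\Gamma)$.
   Context: Graphs are undirected, with no loops or parallel edges; $K_X$ is the complete graph on $X$, having every edge $\{x,y\}$ with $x,y\in X$, $x\ne y$. $\operatorname{Sym}(X)$ is the group of all permutations of $X$. For a graph $\Gamma$ with vertex set $X$ and edge set $E$, the graph semigroup $S_\Gamma$ is the semigroup given by the semigroup presentation $\langle X\mid xy=yx \text{ for all } \{x,y\}\in E\rangle$, i.e. the quotient of the free semigroup $X^+$ (non-empty words over $X$ under concatenation) by the congruence generated by $\{(xy,yx):\{x,y\}\in E\}$. $\operatorname{Aut}(\Gamma)$ is the group of graph automorphisms of $\Gamma$, $I(\Gamma)=\{\alpha\in\operatorname{Aut}(\Gamma):\alpha^2=\mathrm{id}\neq\alpha\}$, and $\mathscr C(\Gamma)=\langle I(\Gamma)\rangle$ is the subgroup of $\operatorname{Aut}(\Gamma)$ generated by $I(\Gamma)$. For a semigroup $S$, an involution of $S$ is a bijection $\alpha:S\to S$ with $\alpha(xy)=\alpha(y)\alpha(x)$ for all $x,y\in S$ and $\alpha^2=\mathrm{id}_S\ne\alpha$; $I(S)$ is the set of all involutions of $S$, and $\mathscr C(S)=\langle I(S)\rangle$ is the subgroup of $\operatorname{Sym}(S)$ generated by $I(S)$ (trivial if $I(S)=\emptyset$).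 *)

theory Defs
  imports "HOL-Algebra.Bij" "HOL-Algebra.Elementary_Groups"
begin

section \<open>Graphs and their automorphisms\<close>

definition complete_edges :: "'a set \<Rightarrow> 'a set set"
  where "complete_edges X = {{x, y} | x y. x \<in> X \<and> y \<in> X \<and> x \<noteq> y}"

text \<open>A graph is a vertex set \<open>X\<close> together with a set \<open>E\<close> of two-element subsets of \<open>X\<close>;
  thus \<open>K\<^sub>X\<close> is the case \<open>E = complete_edges X\<close>.\<close>

definition simple_graph :: "'a set \<Rightarrow> 'a set set \<Rightarrow> bool"
  where "simple_graph X E \<longleftrightarrow> E \<subseteq> complete_edges X"

text \<open>As everywhere in HOL-Algebra, permutations of \<open>X\<close> are represented by functions that
  are extensional on \<open>X\<close>; \<^const>\<open>BijGroup\<close> is the group of all of them.\<close>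

definition graph_auts :: "'a set \<Rightarrow> 'a set set \<Rightarrow> ('a \<Rightarrow> 'a) set"
  where "graph_auts X E =
    {\<alpha> \<in> Bij X. \<forall>x\<in>X. \<forall>y\<in>X. {\<alpha> x, \<alpha> y} \<in> E \<longleftrightarrow> {x, y} \<in> E}"

definition graph_aut_group :: "'a set \<Rightarrow> 'a set set \<Rightarrow> ('a \<Rightarrow> 'a) monoid"
  where "graph_aut_group X E = BijGroup X \<lparr>carrier := graph_auts X E\<rparr>"

definition graph_involutions :: "'a set \<Rightarrow> 'a set set \<Rightarrow> ('a \<Rightarrow> 'a) set"
  where "graph_involutions X E =
    {\<alpha> \<in> graph_auts X E. compose X \<alpha> \<alpha> = (\<lambda>x\<in>X. x) \<and> \<alpha> \<noteq> (\<lambda>x\<in>X. x)}"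

definition graph_involution_group :: "'a set \<Rightarrow> 'a set set \<Rightarrow> ('a \<Rightarrow> 'a) monoid"
  where "graph_involution_group X E =
    subgroup_generated (graph_aut_group X E) (graph_involutions X E)"


section \<open>Semigroups and their involutions\<close>

record 'a sgrp = "'a partial_object" +
  sgmult :: "'a \<Rightarrow> 'a \<Rightarrow> 'a"  (infixl \<open>\<cdot>\<index>\<close> 70)

definition is_semigroup :: "('a, 'b) sgrp_scheme \<Rightarrow> bool"
  where "is_semigroup S \<longleftrightarrow>
    (\<forall>x\<in>carrier S. \<forall>y\<in>carrier S. x \<cdot>\<^bsub>S\<^esub> y \<in> carrier S) \<and>
    (\<forall>x\<in>carrier S. \<forall>y\<in>carrier S. \<forall>z\<in>carrier S.
       (x \<cdot>\<^bsub>S\<^esub> y) \<cdot>\<^bsub>S\<^esub> z = x \<cdot>\<^bsub>S\<^esub> (y \<cdot>\<^bsub>S\<^esub> z))"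

definition involutions :: "('a, 'b) sgrp_scheme \<Rightarrow> ('a \<Rightarrow> 'a) set"
  where "involutions S =
    {\<alpha> \<in> Bij (carrier S).
       (\<forall>x\<in>carrier S. \<forall>y\<in>carrier S. \<alpha> (x \<cdot>\<^bsub>S\<^esub> y) = \<alpha> y \<cdot>\<^bsub>S\<^esub> \<alpha> x) \<and>
       compose (carrier S) \<alpha> \<alpha> = (\<lambda>x\<in>carrier S. x) \<and> \<alpha> \<noteq> (\<lambda>x\<in>carrier S. x)}"

definition involution_group :: "('a, 'b) sgrp_scheme \<Rightarrow> ('a \<Rightarrow> 'a) monoid"
  where "involution_group S = subgroup_generated (BijGroup (carrier S)) (involutions S)"


section \<open>Semigroup presentations and graph semigroups\<close>

definition sg_congruence :: "('a, 'b) sgrp_scheme \<Rightarrow> ('a \<times> 'a) set \<Rightarrow> bool"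
  where "sg_congruence S r \<longleftrightarrow> equiv (carrier S) r \<and>
    (\<forall>a b c d. (a, b) \<in> r \<longrightarrow> (c, d) \<in> r \<longrightarrow> (a \<cdot>\<^bsub>S\<^esub> c, b \<cdot>\<^bsub>S\<^esub> d) \<in> r)"

text \<open>For relations that are not contained in \<open>carrier S \<times> carrier S\<close> the intersection is over
  the empty family and the value is meaningless.\<close>

definition generated_congruence :: "('a, 'b) sgrp_scheme \<Rightarrow> ('a \<times> 'a) set \<Rightarrow> ('a \<times> 'a) set"
  where "generated_congruence S R = \<Inter>{r. sg_congruence S r \<and> R \<subseteq> r}"

text \<open>The union in the product of two classes is over a family of equal classes,
  see \<open>quotient_sgrp_mult\<close> below.\<close>

definition quotient_sgrp :: "('a, 'b) sgrp_scheme \<Rightarrow> ('a \<times> 'a) set \<Rightarrow> 'a set sgrp"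
  where "quotient_sgrp S r =
    \<lparr>carrier = carrier S // r,
     sgmult = \<lambda>A B. \<Union>a\<in>A. \<Union>b\<in>B. r `` {a \<cdot>\<^bsub>S\<^esub> b}\<rparr>"

definition free_sgrp :: "'a set \<Rightarrow> 'a list sgrp"
  where "free_sgrp X = \<lparr>carrier = lists X - {[]}, sgmult = (@)\<rparr>"

definition presented_sgrp :: "'a set \<Rightarrow> ('a list \<times> 'a list) set \<Rightarrow> 'a list set sgrp"
  where "presented_sgrp X R =
    quotient_sgrp (free_sgrp X) (generated_congruence (free_sgrp X) R)"

definition graph_relations :: "'a set set \<Rightarrow> ('a list \<times> 'a list) set"
  where "graph_relations E = {([x, y], [y, x]) | x y. {x, y} \<in> E}"

definition graph_sgrp :: "'a set \<Rightarrow> 'a set set \<Rightarrow> 'a list set sgrp"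
  where "graph_sgrp X E = presented_sgrp X (graph_relations E)"


section \<open>Well-definedness of the constructions\<close>

lemma subgroup_graph_auts: "subgroup (graph_auts X E) (BijGroup X)"
proof (rule group.subgroupI[OF group_BijGroup])
  show "graph_auts X E \<subseteq> carrier (BijGroup X)"
    by (auto simp: graph_auts_def BijGroup_def)
  have "(\<lambda>x\<in>X. x) \<in> graph_auts X E"
    by (simp add: graph_auts_def id_Bij)
  then show "graph_auts X E \<noteq> {}" by blast
next
  fix f assume f: "f \<in> graph_auts X E"
  then have fB: "f \<in> Bij X" by (simp add: graph_auts_def)
  have edge: "{f x, f y} \<in> E \<longleftrightarrow> {x, y} \<in> E" if "x \<in> X" "y \<in> X" for x y
    using f that by (simp add: graph_auts_def)
  have mem: "inv_into X f x \<in> X" if "x \<in> X" for x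
    using fB that by (rule Bij_inv_into_mem)
  have right: "f (inv_into X f x) = x" if "x \<in> X" for x
    using fB that bij_betw_inv_into_right[of f X X x] by (simp add: Bij_def)
  have "{inv_into X f x, inv_into X f y} \<in> E \<longleftrightarrow> {x, y} \<in> E" if "x \<in> X" "y \<in> X" for x y
    using edge[OF mem[OF that(1)] mem[OF that(2)]]
    unfolding right[OF that(1)] right[OF that(2)] by (rule sym)
  then show "inv\<^bsub>BijGroup X\<^esub> f \<in> graph_auts X E"
    using restrict_inv_into_Bij[OF fB] unfolding inv_BijGroup[OF fB]
    by (simp add: graph_auts_def)
next
  fix f g assume fg: "f \<in> graph_auts X E" "g \<in> graph_auts X E"
  then have B: "f \<in> Bij X" "g \<in> Bij X" by (simp_all add: graph_auts_def)
  have "g x \<in> X" if "x \<in> X" for x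
    using Bij_imp_funcset[OF B(2)] that by (rule funcset_mem)
  then have "compose X f g \<in> graph_auts X E"
    using fg compose_Bij[OF B] by (simp add: graph_auts_def compose_eq)
  then show "f \<otimes>\<^bsub>BijGroup X\<^esub> g \<in> graph_auts X E"
    using B by (simp add: BijGroup_def)
qed

lemma group_graph_aut_group: "group (graph_aut_group X E)"
  unfolding graph_aut_group_def
  using subgroup.subgroup_is_group[OF subgroup_graph_auts group_BijGroup] .

lemma sg_congruence_generated:
  assumes "is_semigroup S" "R \<subseteq> carrier S \<times> carrier S"
  shows "sg_congruence S (generated_congruence S R)"
    and "R \<subseteq> generated_congruence S R"
proof -
  let ?G = "generated_congruence S R"
  have top: "sg_congruence S (carrier S \<times> carrier S)"
    using assms(1)
    by (auto simp: sg_congruence_def is_semigroup_def equiv_def refl_on_def sym_def trans_def)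
  have G: "p \<in> ?G \<longleftrightarrow> (\<forall>r. sg_congruence S r \<longrightarrow> R \<subseteq> r \<longrightarrow> p \<in> r)" for p
    by (auto simp: generated_congruence_def)
  have eq: "equiv (carrier S) r" if "sg_congruence S r" for r
    using that by (simp add: sg_congruence_def)
  have "equiv (carrier S) ?G"
  proof (rule equivI)
    show "?G \<subseteq> carrier S \<times> carrier S"
      using top assms(2) G by blast
    show "refl_on (carrier S) ?G"
      using eq by (simp add: refl_on_def G equiv_def)
    show "sym ?G"
    proof (rule symI)
      fix x y assume "(x, y) \<in> ?G"
      then show "(y, x) \<in> ?G"
        using eq unfolding G by (meson equivE symD)
    qed
    show "trans ?G"
    proof (rule transI)
      fix x y z assume "(x, y) \<in> ?G" "(y, z) \<in> ?G"
      then show "(x, z) \<in> ?G"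
        using eq unfolding G by (meson equivE transD)
    qed
  qed
  moreover have "(a \<cdot>\<^bsub>S\<^esub> c, b \<cdot>\<^bsub>S\<^esub> d) \<in> ?G" if "(a, b) \<in> ?G" "(c, d) \<in> ?G" for a b c d
    unfolding G
  proof (intro allI impI)
    fix r assume "sg_congruence S r" "R \<subseteq> r"
    moreover from this have "(a, b) \<in> r" "(c, d) \<in> r"
      using that G by blast+
    ultimately show "(a \<cdot>\<^bsub>S\<^esub> c, b \<cdot>\<^bsub>S\<^esub> d) \<in> r"
      by (simp add: sg_congruence_def)
  qed
  ultimately show "sg_congruence S ?G"
    by (simp add: sg_congruence_def)
  show "R \<subseteq> ?G"
    using G by blast
qed

lemma quotient_sgrp_mult:
  assumes "sg_congruence S r" "a \<in> carrier S" "b \<in> carrier S"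
  shows "r `` {a} \<cdot>\<^bsub>quotient_sgrp S r\<^esub> r `` {b} = r `` {a \<cdot>\<^bsub>S\<^esub> b}"
proof -
  have eq: "equiv (carrier S) r" using assms(1) by (simp add: sg_congruence_def)
  have "congruent2 r r (\<lambda>a b. r `` {a \<cdot>\<^bsub>S\<^esub> b})"
  proof (rule congruent2I')
    fix a a' b b' assume "(a, a') \<in> r" "(b, b') \<in> r"
    then have "(a \<cdot>\<^bsub>S\<^esub> b, a' \<cdot>\<^bsub>S\<^esub> b') \<in> r"
      using assms(1) by (simp add: sg_congruence_def)
    then show "r `` {a \<cdot>\<^bsub>S\<^esub> b} = r `` {a' \<cdot>\<^bsub>S\<^esub> b'}"
      by (rule equiv_class_eq[OF eq])
  qed
  from UN_equiv_class2[OF eq eq this assms(2,3)] show ?thesis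
    by (simp add: quotient_sgrp_def)
qed

lemma is_semigroup_quotient:
  assumes S: "is_semigroup S" and r: "sg_congruence S r"
  shows "is_semigroup (quotient_sgrp S r)"
proof -
  let ?Q = "quotient_sgrp S r"
  have c: "\<exists>a\<in>carrier S. A = r `` {a}" if "A \<in> carrier ?Q" for A
    using that by (auto simp: quotient_sgrp_def elim: quotientE)
  have i: "r `` {a} \<in> carrier ?Q" if "a \<in> carrier S" for a
    using that by (simp add: quotient_sgrp_def quotientI)
  have cl: "a \<cdot>\<^bsub>S\<^esub> b \<in> carrier S" if "a \<in> carrier S" "b \<in> carrier S" for a b
    using S that by (simp add: is_semigroup_def)
  have as: "(a \<cdot>\<^bsub>S\<^esub> b) \<cdot>\<^bsub>S\<^esub> d = a \<cdot>\<^bsub>S\<^esub> (b \<cdot>\<^bsub>S\<^esub> d)"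
    if "a \<in> carrier S" "b \<in> carrier S" "d \<in> carrier S" for a b d
    using S that by (simp add: is_semigroup_def)
  note m = quotient_sgrp_mult[OF r]
  show ?thesis
    unfolding is_semigroup_def
  proof (intro conjI ballI)
    fix A B assume "A \<in> carrier ?Q" "B \<in> carrier ?Q"
    then obtain a b where "a \<in> carrier S" "A = r `` {a}" "b \<in> carrier S" "B = r `` {b}"
      using c by blast
    then show "A \<cdot>\<^bsub>?Q\<^esub> B \<in> carrier ?Q"
      by (simp only: m cl i)
  next
    fix A B D assume "A \<in> carrier ?Q" "B \<in> carrier ?Q" "D \<in> carrier ?Q"
    then obtain a b d where "a \<in> carrier S" "A = r `` {a}" "b \<in> carrier S" "B = r `` {b}"
        "d \<in> carrier S" "D = r `` {d}"
      using c by meson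
    then show "(A \<cdot>\<^bsub>?Q\<^esub> B) \<cdot>\<^bsub>?Q\<^esub> D = A \<cdot>\<^bsub>?Q\<^esub> (B \<cdot>\<^bsub>?Q\<^esub> D)"
      by (simp only: m cl as)
  qed
qed

lemma is_semigroup_free: "is_semigroup (free_sgrp X)"
  by (auto simp: is_semigroup_def free_sgrp_def)

lemma graph_relations_subset:
  assumes "simple_graph X E"
  shows "graph_relations E \<subseteq> carrier (free_sgrp X) \<times> carrier (free_sgrp X)"
proof
  fix p assume "p \<in> graph_relations E"
  then obtain x y where p: "p = ([x, y], [y, x])" "{x, y} \<in> E"
    by (auto simp: graph_relations_def)
  then have "{x, y} \<in> complete_edges X"
    using assms by (auto simp: simple_graph_def)
  then have "x \<in> X" "y \<in> X"
    by (auto simp: complete_edges_def doubleton_eq_iff)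
  then show "p \<in> carrier (free_sgrp X) \<times> carrier (free_sgrp X)"
    using p by (simp add: free_sgrp_def)
qed

lemma is_semigroup_graph_sgrp:
  assumes "simple_graph X E"
  shows "is_semigroup (graph_sgrp X E)"
  unfolding graph_sgrp_def presented_sgrp_def
  by (rule is_semigroup_quotient[OF is_semigroup_free sg_congruence_generated(1)
        [OF is_semigroup_free graph_relations_subset[OF assms]]])

end

theory Submission
  imports Defs "HOL-Library.Multiset"
begin

text \<open>An involution of \<open>S\<^sub>\<Gamma>\<close> permutes the irreducible elements, which are the vertices, and
  it preserves commutation between them; so it is \<open>\<rho> \<circ> \<alpha>\<close>, where \<open>\<rho>\<close> is the reversal of words
  and \<open>\<alpha>\<close> is induced by a graph automorphism with \<open>\<alpha>\<^sup>2 = 1\<close>. Reversal commutes with all induced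
  automorphisms. For \<open>\<Gamma> = K\<^sub>X\<close> reversal is trivial, and every permutation of \<open>X\<close> is a product of two
  involutions. Otherwise \<open>\<rho>\<close> is an involution that is not induced by a graph automorphism, and it
  splits off as a direct factor of order two.\<close>


section \<open>Groups generated by images of homomorphisms\<close>

text \<open>A homomorphism carries the subgroup generated by \<open>I\<close> onto the one generated
  by the image of \<open>I\<close>, and injectivity makes its restriction bijective. Since
  \<open>subgroup_generated\<close> intersects its generators with the carrier,
  \<open>I \<subseteq> carrier G\<close> ensures that none of them is lost.\<close>

lemma (in group_hom) subgroup_generated_image_iso:
  assumes "inj_on h (carrier G)" "I \<subseteq> carrier G"
  shows "subgroup_generated H (h ` I) \<cong> subgroup_generated G I"
proof -
  have hI: "h ` I \<subseteq> carrier H"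
    using assms(2) by auto
  have sub: "generate G I \<subseteq> carrier G"
    using assms(2) by (rule G.generate_incl)
  have c: "carrier (subgroup_generated G I) = generate G I"
      "carrier (subgroup_generated H (h ` I)) = h ` generate G I"
    using assms(2) hI generate_img[OF assms(2)]
    by (simp_all add: carrier_subgroup_generated Int_absorb1)
  have "h \<in> iso (subgroup_generated G I) (subgroup_generated H (h ` I))"
    using sub inj_on_subset[OF assms(1) sub] unfolding iso_def hom_def c
    by (auto simp: bij_betw_def c subset_iff)
  then have "subgroup_generated G I \<cong> subgroup_generated H (h ` I)"
    by (auto simp: is_iso_def)
  then show ?thesis
    by (rule group.iso_sym[OF G.group_subgroup_generated])
qed

text \<open>Inserting \<open>\<one>\<close> makes \<open>r\<close> itself a generator, and
  \<open>r (r (h a)) = h a\<close> then recovers the image of \<open>I\<close>. So the generated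
  group is the product of the order-two group of \<open>r\<close> and a copy of
  \<open>generate G I\<close>; it is direct because \<open>r\<close> commutes with the image of
  \<open>h\<close> and lies outside it.\<close>

lemma (in group_hom) subgroup_generated_twisted_image_iso:
  assumes inj: "inj_on h (carrier G)" and I: "I \<subseteq> carrier G"
    and r: "r \<in> carrier H" "r \<otimes>\<^bsub>H\<^esub> r = \<one>\<^bsub>H\<^esub>" "r \<notin> h ` carrier G"
    and comm: "\<And>a. a \<in> carrier G \<Longrightarrow> h a \<otimes>\<^bsub>H\<^esub> r = r \<otimes>\<^bsub>H\<^esub> h a"
  shows "subgroup_generated H ((\<lambda>a. r \<otimes>\<^bsub>H\<^esub> h a) ` insert \<one> I)
    \<cong> integer_mod_group 2 \<times>\<times> subgroup_generated G I"
proof -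
  define J where "J = (\<lambda>a. r \<otimes>\<^bsub>H\<^esub> h a) ` insert \<one> I"
  define D where "D = integer_mod_group 2 \<times>\<times> subgroup_generated G I"
  \<comment> \<open>The first factor has carrier \<open>{0, 1}\<close>, whose elements select the
    identity and \<open>r\<close>.\<close>
  define k where "k = (\<lambda>(n::int, a). (if n = 0 then \<one>\<^bsub>H\<^esub> else r) \<otimes>\<^bsub>H\<^esub> h a)"
  have J: "J \<subseteq> carrier H"
    using I r by (auto simp: J_def)
  have sub: "generate G I \<subseteq> carrier G"
    using I by (rule G.generate_incl)
  then have subD: "a \<in> carrier G" if "a \<in> generate G I" for a
    using that by blast
  have cG: "carrier (subgroup_generated G I) = generate G I"
    using I by (simp add: carrier_subgroup_generated Int_absorb1)
  have cH: "carrier (subgroup_generated H J) = generate H J"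
    using J by (simp add: carrier_subgroup_generated Int_absorb1)
  have n2: "{0..<2::int} = {0, 1}"
    by auto
  have cD: "carrier D = {0, 1} \<times> generate G I"
    by (simp add: D_def DirProd_def carrier_integer_mod_group cG n2)
  have gD: "group D"
    unfolding D_def by (intro DirProd_group group_integer_mod_group G.group_subgroup_generated)
  have multD: "(m, a) \<otimes>\<^bsub>D\<^esub> (n, b) = ((m + n) mod 2, a \<otimes> b)" for m n a b
    by (simp add: D_def DirProd_def)
  have rr: "r \<otimes>\<^bsub>H\<^esub> (r \<otimes>\<^bsub>H\<^esub> b) = b" if "b \<in> carrier H" for b
    using that r by (simp flip: H.m_assoc)
  have rh: "h a \<otimes>\<^bsub>H\<^esub> (r \<otimes>\<^bsub>H\<^esub> b) = r \<otimes>\<^bsub>H\<^esub> (h a \<otimes>\<^bsub>H\<^esub> b)"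
    if "a \<in> carrier G" "b \<in> carrier H" for a b
    using that r comm by (simp flip: H.m_assoc)
  have k_hom: "k \<in> hom D H"
  proof (rule homI)
    fix p assume "p \<in> carrier D"
    then show "k p \<in> carrier H"
      using r subD by (auto simp: cD k_def)
  next
    fix p q assume "p \<in> carrier D" "q \<in> carrier D"
    then show "k (p \<otimes>\<^bsub>D\<^esub> q) = k p \<otimes>\<^bsub>H\<^esub> k q"
      using r subD by (auto simp: cD multD k_def H.m_assoc rr rh comm)
  qed
  \<comment> \<open>The image of \<open>h\<close> and its coset by \<open>r\<close> are disjoint,
    since otherwise \<open>r = h (b a^-1)\<close>. Hence the first coordinate can be read off a
    value of \<open>k\<close>.\<close>
  have noth: "r \<otimes>\<^bsub>H\<^esub> h a \<noteq> h b" if "a \<in> carrier G" "b \<in> carrier G" for a b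
  proof
    assume "r \<otimes>\<^bsub>H\<^esub> h a = h b"
    then have "r = h b \<otimes>\<^bsub>H\<^esub> inv\<^bsub>H\<^esub> h a"
      using that r H.inv_solve_right by auto
    also have "\<dots> = h (b \<otimes> inv a)"
      using that by simp
    finally show False
      using r(3) that by blast
  qed
  have k_inj: "inj_on k (carrier D)"
  proof (rule inj_onI)
    fix p q assume "p \<in> carrier D" "q \<in> carrier D" "k p = k q"
    then obtain m a n b where p: "p = (m, a)" "m \<in> {0, 1}" "a \<in> carrier G"
      and q: "q = (n, b)" "n \<in> {0, 1}" "b \<in> carrier G" and eq: "k (m, a) = k (n, b)"
      using subD by (auto simp: cD)
    then have "m = n"
      using noth[of a b] noth[of b a] by (auto simp: k_def)
    moreover from this have "h a = h b"
      using eq p q r by (auto simp: k_def split: if_splits)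
    then have "a = b"
      using inj p q by (simp add: inj_on_eq_iff)
    ultimately show "p = q"
      using p q by simp
  qed
  interpret k: group_hom D H k
    by (intro group_hom.intro gD H.group_axioms group_hom_axioms.intro k_hom)
  have k0: "k (0, a) = h a" if "a \<in> carrier G" for a
    using that by (simp add: k_def)
  have k1: "k (1, a) = r \<otimes>\<^bsub>H\<^esub> h a" for a
    by (simp add: k_def)
  have "k ` carrier D = generate H J"
  proof
    have "J \<subseteq> k ` carrier D"
      unfolding J_def cD k1[symmetric]
      by (rule image_subsetI, rule imageI) (auto intro: generate.one generate.incl)
    then show "generate H J \<subseteq> k ` carrier D"
      by (rule H.generate_subgroup_incl) (rule k.img_is_subgroup)
  next
    have sg: "subgroup (generate H J) H"
      using J by (rule H.generate_is_subgroup)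
    \<comment> \<open>This is the element contributed by \<open>\<one>\<close>, because
      \<open>h \<one>\<close> is the identity of \<open>H\<close>.\<close>
    have "r \<in> J"
      using r unfolding J_def by (force intro: image_eqI[of _ _ \<one>])
    then have rJ: "r \<in> generate H J"
      by (rule generate.incl)
    have "h a \<in> generate H J" if "a \<in> I" for a
    proof -
      have "r \<otimes>\<^bsub>H\<^esub> h a \<in> generate H J"
        using that unfolding J_def by (intro generate.incl) simp
      then have "r \<otimes>\<^bsub>H\<^esub> (r \<otimes>\<^bsub>H\<^esub> h a) \<in> generate H J"
        by (rule generate.eng[OF rJ])
      then show ?thesis
        using that I rr[of "h a"] by auto
    qed
    then have "generate H (h ` I) \<subseteq> generate H J"
      by (intro H.generate_subgroup_incl[OF _ sg]) blast
    then have hJ: "h a \<in> generate H J" if "a \<in> generate G I" for a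
      using that generate_img[OF I] by blast
    then show "k ` carrier D \<subseteq> generate H J"
      using k0 k1 subD generate.eng[OF rJ] by (auto simp: cD)
  qed
  then have "k \<in> iso D (subgroup_generated H J)"
    using k_hom k_inj by (auto simp: iso_def hom_def bij_betw_def cH)
  then have "D \<cong> subgroup_generated H J"
    by (auto simp: is_iso_def)
  then show ?thesis
    unfolding J_def D_def by (rule group.iso_sym[OF gD[unfolded D_def]])
qed


section \<open>Permutations as products of two involutions\<close>

lemma Bij_involI:
  assumes "s \<in> extensional X" "\<And>x. x \<in> X \<Longrightarrow> s x \<in> X" "\<And>x. x \<in> X \<Longrightarrow> s (s x) = x"
  shows "s \<in> Bij X" "compose X s s = (\<lambda>x\<in>X. x)"
proof -
  have "bij_betw s X X"
    by (rule bij_betw_byWitness[of _ s]) (use assms in auto)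
  then show "s \<in> Bij X"
    using assms by (simp add: Bij_def)
  show "compose X s s = (\<lambda>x\<in>X. x)"
    using assms by (auto simp: compose_def)
qed

text \<open>Each orbit of \<open>f\<close> is a line or a cycle \<open>{f\<^sup>i r | i \<in> \<int>}\<close>; the involution \<open>s\<close> is its
  reflection \<open>f\<^sup>i r \<mapsto> f\<^sup>-\<^sup>i r\<close>, and \<open>f s\<close> is the reflection
  \<open>f\<^sup>i r \<mapsto> f\<^sup>1\<^sup>-\<^sup>i r\<close>.\<close>

lemma Bij_product_of_two_involutions:
  assumes f: "f \<in> Bij X"
  obtains s t where "s \<in> Bij X" "compose X s s = (\<lambda>x\<in>X. x)"
    "t \<in> Bij X" "compose X t t = (\<lambda>x\<in>X. x)" "f = compose X t s"
proof -
  interpret B: group "BijGroup X"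
    by (rule group_BijGroup)
  define P where "P i = f [^]\<^bsub>BijGroup X\<^esub> i" for i :: int
  have cB: "carrier (BijGroup X) = Bij X" and oneB: "\<one>\<^bsub>BijGroup X\<^esub> = (\<lambda>x\<in>X. x)"
    and multB: "\<And>g h. \<lbrakk>g \<in> Bij X; h \<in> Bij X\<rbrakk> \<Longrightarrow> g \<otimes>\<^bsub>BijGroup X\<^esub> h = compose X g h"
    by (simp_all add: BijGroup_def)
  have fB: "f \<in> carrier (BijGroup X)"
    using f by (simp only: cB)
  have PB: "P i \<in> Bij X" for i
    using B.int_pow_closed[OF fB, of i] unfolding P_def cB .
  have PX: "P i x \<in> X" if "x \<in> X" for i x
    using funcset_mem[OF Bij_imp_funcset[OF PB] that] .
  have P_add: "P i (P j x) = P (i + j) x" if "x \<in> X" for i j x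
  proof -
    have "P (i + j) = P i \<otimes>\<^bsub>BijGroup X\<^esub> P j"
      unfolding P_def by (rule B.int_pow_mult[OF fB])
    then show ?thesis
      using that by (simp add: multB PB compose_eq)
  qed
  have P0: "P 0 x = x" if "x \<in> X" for x
    using that by (simp add: P_def oneB)
  have P1: "P 1 = f"
    using fB by (simp add: P_def B.int_pow_1)
  \<comment> \<open>This chooses a base point on each orbit of \<open>f\<close>. The choice
    predicate depends on \<open>x\<close> only through its orbit, so \<open>rep\<close> is constant
    on orbits.\<close>
  define rep where "rep x = (SOME y. y \<in> range (\<lambda>i. P i x))" for x
  have rep_ex: "\<exists>i. rep x = P i x" for x
    using someI_ex[of "\<lambda>y. y \<in> range (\<lambda>i. P i x)"] unfolding rep_def by blast
  have repX: "rep x \<in> X" if "x \<in> X" for x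
    using rep_ex[of x] PX[OF that] by auto
  have rep_P: "rep (P j x) = rep x" if "x \<in> X" for j x
  proof -
    have "range (\<lambda>i. P i (P j x)) = range (\<lambda>i. P i x)"
    proof
      show "range (\<lambda>i. P i (P j x)) \<subseteq> range (\<lambda>i. P i x)"
        using that by (auto simp: P_add)
      show "range (\<lambda>i. P i x) \<subseteq> range (\<lambda>i. P i (P j x))"
      proof
        fix y assume "y \<in> range (\<lambda>i. P i x)"
        then obtain i where "y = P i x" by blast
        then have "y = P (i - j) (P j x)"
          using that by (simp add: P_add)
        then show "y \<in> range (\<lambda>i. P i (P j x))" by blast
      qed
    qed
    then show ?thesis
      by (simp add: rep_def)
  qed
  have coord: "\<exists>k. x = P k (rep x)" if "x \<in> X" for x
  proof -
    obtain i where "rep x = P i x" using rep_ex by blast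
    then have "x = P (- i) (rep x)"
      using that by (simp add: P_add P0)
    then show ?thesis ..
  qed
  \<comment> \<open>On a finite cycle the exponent of a point is determined only modulo the length
    of the cycle. The next fact shows that the value does not depend on the exponent chosen.\<close>
  define refl where
    "refl c = (\<lambda>x\<in>X. P (c - (SOME k. x = P k (rep x))) (rep x))" for c
  have refl: "refl c (P k (rep x)) = P (c - k) (rep x)" if "x \<in> X" for c k x
  proof -
    let ?r = "rep x"
    define k' where "k' = (SOME k'. P k ?r = P k' ?r)"
    have r: "?r \<in> X" "rep (P k ?r) = ?r"
      using that rep_ex[of x] rep_P by (auto simp: repX)
    have "P k ?r = P k' ?r"
      unfolding k'_def by (rule someI[of _ k]) simp
    \<comment> \<open>The exponent \<open>c - k - k'\<close> is symmetric in \<open>k\<close> and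
      \<open>k'\<close>: it takes the equal points \<open>P k' r\<close> and \<open>P k r\<close> to
      \<open>P (c - k) r\<close> and \<open>P (c - k') r\<close>, where
      \<open>r = rep x\<close>.\<close>
    then have "P (c - k - k') (P k' ?r) = P (c - k - k') (P k ?r)"
      by simp
    then have "P (c - k) ?r = P (c - k') ?r"
      using r by (simp add: P_add)
    then show ?thesis
      using r by (simp add: refl_def PX k'_def)
  qed
  have rX: "refl c x \<in> X" if "x \<in> X" for c x
    using that by (simp add: refl_def PX repX)
  \<comment> \<open>Exponents compose as \<open>c - (d - k) = (c - d) + k\<close>, so two
    reflections give a power of \<open>f\<close>: the identity for \<open>c = d\<close>, and
    \<open>f\<close> itself for \<open>c = 1\<close> and \<open>d = 0\<close>.\<close>
  have rr: "refl c (refl d x) = P (c - d) x" if x: "x \<in> X" for c d x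
  proof -
    obtain k where k: "x = P k (rep x)" using coord[OF x] ..
    then have "refl c (refl d x) = refl c (refl d (P k (rep x)))"
      by simp
    also have "\<dots> = P (c - d + k) (rep x)"
      using x by (simp add: refl algebra_simps)
    also have "\<dots> = P (c - d) (P k (rep x))"
      using x by (simp add: P_add repX)
    finally show ?thesis
      using k by simp
  qed
  have inv: "refl c \<in> Bij X" "compose X (refl c) (refl c) = (\<lambda>x\<in>X. x)" for c
    using Bij_involI[of "refl c" X] by (simp_all add: rX rr P0) (simp_all add: refl_def)
  have "f = compose X (refl 1) (refl 0)"
    by (rule extensionalityI[of _ X])
      (use Bij_imp_extensional[OF f] in \<open>auto simp: compose_eq rr P1\<close>)
  with inv that show thesis by blast
qed


section \<open>Graph semigroups\<close>

lemma in_free_sgrp [simp]: "u \<in> carrier (free_sgrp X) \<longleftrightarrow> set u \<subseteq> X \<and> u \<noteq> []"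
  by (auto simp: free_sgrp_def)

lemma mult_free_sgrp [simp]: "u \<cdot>\<^bsub>free_sgrp X\<^esub> v = u @ v"
  by (simp add: free_sgrp_def)

locale graph_semigroup =
  fixes X :: "'a set" and E :: "'a set set"
  assumes graph: "simple_graph X E"
begin

abbreviation F where "F \<equiv> carrier (free_sgrp X)"
abbreviation S where "S \<equiv> graph_sgrp X E"
abbreviation cong where "cong \<equiv> generated_congruence (free_sgrp X) (graph_relations E)"

definition cls where "cls u = cong `` {u}"

lemma edgeD: "{x, y} \<in> E \<Longrightarrow> x \<in> X \<and> y \<in> X \<and> x \<noteq> y"
  using graph by (fastforce simp: simple_graph_def complete_edges_def doubleton_eq_iff)

lemma cong: "sg_congruence (free_sgrp X) cong" "graph_relations E \<subseteq> cong"
  by (rule sg_congruence_generated[OF is_semigroup_free graph_relations_subset[OF graph]])+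

lemma equiv_cong: "equiv F cong"
  using cong(1) by (simp add: sg_congruence_def)

lemma cls_eq_iff:
  assumes "u \<in> F" "v \<in> F"
  shows "cls u = cls v \<longleftrightarrow> (u, v) \<in> cong"
  unfolding cls_def using eq_equiv_class_iff[OF equiv_cong assms] .

lemma carrier_S: "carrier S = cls ` F"
  by (auto simp: graph_sgrp_def presented_sgrp_def quotient_sgrp_def quotient_def cls_def)

lemma cls_in_S: "u \<in> F \<Longrightarrow> cls u \<in> carrier S"
  by (simp add: carrier_S)

lemma cls_mult:
  assumes "u \<in> F" "v \<in> F"
  shows "cls u \<cdot>\<^bsub>S\<^esub> cls v = cls (u @ v)"
  using quotient_sgrp_mult[OF cong(1) assms]
  by (simp add: graph_sgrp_def presented_sgrp_def cls_def)

lemma cls_edge: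
  assumes "{x, y} \<in> E"
  shows "cls [x, y] = cls [y, x]"
proof -
  have "([x, y], [y, x]) \<in> cong"
    using cong(2) assms by (auto simp: graph_relations_def)
  then show ?thesis
    using edgeD[OF assms] by (simp add: cls_eq_iff)
qed

section \<open>Invariants of the classes of words\<close>

text \<open>The relation \<open>k a = k b\<close> is a congruence on the free semigroup that
  contains the defining relations, so it contains the congruence they generate. The values of
  \<open>k\<close> carry no multiplication: \<open>mult\<close> states that the kernel of
  \<open>k\<close> respects concatenation.\<close>

lemma cls_invariant:
  assumes uv: "u \<in> F" "v \<in> F" "cls u = cls v"
    and mult: "\<And>a b c d. \<lbrakk>a \<in> F; b \<in> F; c \<in> F; d \<in> F; k a = k b; k c = k d\<rbrakk>
      \<Longrightarrow> k (a @ c) = k (b @ d)"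
    and edge: "\<And>x y. {x, y} \<in> E \<Longrightarrow> k [x, y] = k [y, x]"
  shows "k u = k v"
proof -
  define r where "r = {(a, b). a \<in> F \<and> b \<in> F \<and> k a = k b}"
  have "equiv F r"
    by (rule equivI) (auto simp: r_def refl_on_def sym_def trans_def)
  then have "sg_congruence (free_sgrp X) r"
    using mult by (auto simp: sg_congruence_def r_def)
  moreover have "graph_relations E \<subseteq> r"
    using edge edgeD by (auto simp: graph_relations_def r_def)
  ultimately have "cong \<subseteq> r"
    by (auto simp: generated_congruence_def)
  then show ?thesis
    using uv by (auto simp: cls_eq_iff r_def)
qed

text \<open>The defining relations only exchange letters, so letter counts are invariant.\<close>

lemma cls_eq_imp_mset_eq:
  assumes "u \<in> F" "v \<in> F" "cls u = cls v"
  shows "mset u = mset v"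
  using assms by (rule cls_invariant) (simp_all add: add_mset_commute)

text \<open>A one-letter word is determined by its multiset of letters. Thus \<open>X\<close> embeds
  into the semigroup, and a vertex can be recovered from its class.\<close>

lemma cls_singleton_iff:
  assumes "x \<in> X" "v \<in> F"
  shows "cls [x] = cls v \<longleftrightarrow> v = [x]"
  using cls_eq_imp_mset_eq[of "[x]" v] assms by auto

text \<open>Non-adjacent distinct letters do not commute, because the subword on these two letters
  is an invariant of the class.\<close>

lemma cls_commute_iff:
  assumes "x \<in> X" "y \<in> X"
  shows "cls [x, y] = cls [y, x] \<longleftrightarrow> x = y \<or> {x, y} \<in> E"
proof
  assume eq: "cls [x, y] = cls [y, x]"
  show "x = y \<or> {x, y} \<in> E"
  proof (rule ccontr)
    assume neg: "\<not> (x = y \<or> {x, y} \<in> E)"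
    have "filter (\<lambda>z. z \<in> {x, y}) [x, y] = filter (\<lambda>z. z \<in> {x, y}) [y, x]"
    proof (rule cls_invariant[OF _ _ eq])
      \<comment> \<open>An edge has two distinct endpoints and differs from \<open>{x, y}\<close>,
        so at most one endpoint survives the filter and the order is immaterial.\<close>
      fix a b assume "{a, b} \<in> E"
      then show "filter (\<lambda>z. z \<in> {x, y}) [a, b] = filter (\<lambda>z. z \<in> {x, y}) [b, a]"
        using neg edgeD[of a b] by (auto simp: insert_commute)
    qed (use assms in simp_all)
    from arg_cong[OF this, of hd] show False
      using neg by simp
  qed
qed (elim disjE, simp, rule cls_edge)


subsection \<open>Maps induced by maps of words\<close>

text \<open>This is the condition for a map of words to descend to the quotient. It speaks of
  classes rather than products, so it covers letterwise maps and reversal alike.\<close>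

definition respectful where
  "respectful h \<longleftrightarrow> h ` F \<subseteq> F \<and> (\<forall>u\<in>F. \<forall>v\<in>F. cls u = cls v \<longrightarrow> cls (h u) = cls (h v))"

text \<open>The union runs over equal classes when \<open>h\<close> is respectful, which gives the
  descended map without choosing representatives. The restriction makes it extensional, as
  membership in \<open>Bij\<close> demands.\<close>

definition induced where
  "induced h = (\<lambda>A\<in>carrier S. \<Union>u\<in>A. cls (h u))"

lemma respectfulI:
  assumes "\<And>u. u \<in> F \<Longrightarrow> h u \<in> F"
    and "\<And>u v. \<lbrakk>u \<in> F; v \<in> F; cls u = cls v\<rbrakk> \<Longrightarrow> cls (h u) = cls (h v)"
  shows "respectful h"
  unfolding respectful_def by (intro conjI image_subsetI ballI impI assms)

lemma respectfulD:
  assumes "respectful h"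
  shows "u \<in> F \<Longrightarrow> h u \<in> F" "\<lbrakk>u \<in> F; v \<in> F; cls u = cls v\<rbrakk> \<Longrightarrow> cls (h u) = cls (h v)"
  using assms unfolding respectful_def by blast+

lemma induced_cls:
  assumes "respectful h" "u \<in> F"
  shows "induced h (cls u) = cls (h u)"
proof -
  have "congruent cong (\<lambda>u. cls (h u))"
  proof (rule congruentI)
    fix y z assume yz: "(y, z) \<in> cong"
    then have "y \<in> F" "z \<in> F"
      using equiv_type[OF equiv_cong] by blast+
    then show "cls (h y) = cls (h z)"
      using respectfulD(2)[OF assms(1)] yz by (simp add: cls_eq_iff)
  qed
  from UN_equiv_class[OF equiv_cong this assms(2)] show ?thesis
    using assms(2) by (simp add: induced_def cls_in_S flip: cls_def)
qed

lemma extensional_S_eqI: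
  assumes "f \<in> extensional (carrier S)" "g \<in> extensional (carrier S)"
    and "\<And>u. u \<in> F \<Longrightarrow> f (cls u) = g (cls u)"
  shows "f = g"
  using assms by (intro extensionalityI[of _ "carrier S"]) (auto simp: carrier_S)

lemma induced_extensional: "induced h \<in> extensional (carrier S)"
  by (simp add: induced_def)

lemma respectful_comp:
  assumes "respectful g" "respectful h"
  shows "respectful (g \<circ> h)"
proof (rule respectfulI)
  fix u assume "u \<in> F"
  then show "(g \<circ> h) u \<in> F"
    unfolding o_apply by (intro respectfulD(1)[OF assms(1)] respectfulD(1)[OF assms(2)])
next
  fix u v assume "u \<in> F" "v \<in> F" "cls u = cls v"
  then show "cls ((g \<circ> h) u) = cls ((g \<circ> h) v)"
    unfolding o_apply by (intro respectfulD[OF assms(1)] respectfulD[OF assms(2)])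
qed

lemma compose_induced:
  assumes "respectful g" "respectful h"
  shows "compose (carrier S) (induced g) (induced h) = induced (g \<circ> h)"
proof (rule extensional_S_eqI)
  fix u assume u: "u \<in> F"
  then show "compose (carrier S) (induced g) (induced h) (cls u) = induced (g \<circ> h) (cls u)"
    using assms respectfulD(1)[OF assms(2) u]
    by (simp only: compose_eq cls_in_S induced_cls respectful_comp o_apply)
qed (simp_all add: induced_extensional)

lemma induced_eqI:
  assumes "respectful g" "respectful h" "\<And>u. u \<in> F \<Longrightarrow> g u = h u"
  shows "induced g = induced h"
  using assms by (intro extensional_S_eqI induced_extensional) (simp only: induced_cls)

lemma induced_idI:
  assumes "respectful h" "\<And>u. u \<in> F \<Longrightarrow> h u = u"
  shows "induced h = (\<lambda>A\<in>carrier S. A)"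
  using assms by (intro extensional_S_eqI induced_extensional)
    (simp_all only: induced_cls restrict_extensional restrict_apply' cls_in_S)

lemma induced_Bij:
  assumes "respectful g" "respectful h"
    and "\<And>u. u \<in> F \<Longrightarrow> g (h u) = u" "\<And>u. u \<in> F \<Longrightarrow> h (g u) = u"
  shows "induced g \<in> Bij (carrier S)"
proof -
  have "bij_betw (induced g) (carrier S) (carrier S)"
    by (rule bij_betw_byWitness[of _ "induced h"])
      (use assms respectfulD(1)[OF assms(1)] respectfulD(1)[OF assms(2)] in
        \<open>auto simp only: carrier_S induced_cls\<close>)
  then show ?thesis
    by (simp add: Bij_def induced_extensional)
qed

section \<open>Reversal and the action of graph automorphisms\<close>

text \<open>The mirror image of a relation \<open>xy = yx\<close> is the same relation read from
  right to left, and reversal merely swaps the factors of a concatenation.\<close>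

lemma respectful_rev: "respectful rev"
proof (rule respectfulI)
  fix u v assume "u \<in> F" "v \<in> F" "cls u = cls v"
  then show "cls (rev u) = cls (rev v)"
  proof (rule cls_invariant)
    fix a b c d
    assume "a \<in> F" "b \<in> F" "c \<in> F" "d \<in> F"
      "cls (rev a) = cls (rev b)" "cls (rev c) = cls (rev d)"
    then show "cls (rev (a @ c)) = cls (rev (b @ d))"
      using cls_mult[of "rev c" "rev a"] cls_mult[of "rev d" "rev b"] by simp
  next
    fix x y assume "{x, y} \<in> E"
    from cls_edge[OF this, symmetric] show "cls (rev [x, y]) = cls (rev [y, x])"
      by simp
  qed
qed simp

lemma graph_autsD:
  assumes "\<alpha> \<in> graph_auts X E"
  shows "\<alpha> \<in> Bij X" "x \<in> X \<Longrightarrow> \<alpha> x \<in> X"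
    "\<lbrakk>x \<in> X; y \<in> X\<rbrakk> \<Longrightarrow> {\<alpha> x, \<alpha> y} \<in> E \<longleftrightarrow> {x, y} \<in> E"
  using assms Bij_imp_funcset[of \<alpha> X] by (auto simp: graph_auts_def)

lemma respectful_map:
  assumes "\<alpha> \<in> graph_auts X E"
  shows "respectful (map \<alpha>)"
proof -
  note a = graph_autsD[OF assms]
  have F: "map \<alpha> u \<in> F" if "u \<in> F" for u
    using that a(2) by auto
  have "cls (map \<alpha> u) = cls (map \<alpha> v)" if "u \<in> F" "v \<in> F" "cls u = cls v" for u v
    using that
  proof (rule cls_invariant)
    fix a b c d
    assume "a \<in> F" "b \<in> F" "c \<in> F" "d \<in> F"
      "cls (map \<alpha> a) = cls (map \<alpha> b)" "cls (map \<alpha> c) = cls (map \<alpha> d)"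
    then show "cls (map \<alpha> (a @ c)) = cls (map \<alpha> (b @ d))"
      using cls_mult[OF F F, of a c] cls_mult[OF F F, of b d] by simp
  next
    fix x y assume "{x, y} \<in> E"
    then show "cls (map \<alpha> [x, y]) = cls (map \<alpha> [y, x])"
      using a(3)[of x y] edgeD[of x y] cls_edge[of "\<alpha> x" "\<alpha> y"] by simp
  qed
  then show ?thesis
    using F by (intro respectfulI)
qed

definition reversal where "reversal = induced rev"
definition aut_map where "aut_map \<alpha> = induced (map \<alpha>)"

lemma reversal_cls: "u \<in> F \<Longrightarrow> reversal (cls u) = cls (rev u)"
  unfolding reversal_def by (rule induced_cls[OF respectful_rev])

lemma aut_map_cls:
  "\<lbrakk>\<alpha> \<in> graph_auts X E; u \<in> F\<rbrakk> \<Longrightarrow> aut_map \<alpha> (cls u) = cls (map \<alpha> u)"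
  unfolding aut_map_def by (rule induced_cls[OF respectful_map])

lemma reversal_Bij: "reversal \<in> Bij (carrier S)"
  unfolding reversal_def by (rule induced_Bij[OF respectful_rev respectful_rev]) simp_all

lemma carrier_graph_aut_group [simp]: "carrier (graph_aut_group X E) = graph_auts X E"
  by (simp add: graph_aut_group_def)

lemma one_graph_aut_group [simp]: "\<one>\<^bsub>graph_aut_group X E\<^esub> = (\<lambda>x\<in>X. x)"
  by (simp add: graph_aut_group_def BijGroup_def)

lemma mult_graph_aut_group:
  assumes "\<alpha> \<in> graph_auts X E" "\<beta> \<in> graph_auts X E"
  shows "\<alpha> \<otimes>\<^bsub>graph_aut_group X E\<^esub> \<beta> = compose X \<alpha> \<beta>"
  using assms graph_autsD(1) by (simp add: graph_aut_group_def BijGroup_def)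

lemma id_graph_auts: "(\<lambda>x\<in>X. x) \<in> graph_auts X E"
  by (simp add: graph_auts_def id_Bij)

lemma compose_graph_auts:
  assumes "\<alpha> \<in> graph_auts X E" "\<beta> \<in> graph_auts X E"
  shows "compose X \<alpha> \<beta> \<in> graph_auts X E"
  using monoid.m_closed[OF group.is_monoid[OF group_graph_aut_group], of \<alpha> X E \<beta>] assms
  by (simp add: mult_graph_aut_group)

lemma aut_map_compose:
  assumes "\<alpha> \<in> graph_auts X E" "\<beta> \<in> graph_auts X E"
  shows "aut_map (compose X \<alpha> \<beta>) = compose (carrier S) (aut_map \<alpha>) (aut_map \<beta>)"
  unfolding aut_map_def compose_induced[OF respectful_map[OF assms(1)] respectful_map[OF assms(2)]]
  using assms
  by (intro induced_eqI respectful_map respectful_comp compose_graph_auts) (auto simp: compose_eq)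

lemma aut_map_id: "aut_map (\<lambda>x\<in>X. x) = (\<lambda>A\<in>carrier S. A)"
  unfolding aut_map_def
  by (rule induced_idI[OF respectful_map[OF id_graph_auts]]) (auto intro!: map_idI)

lemma aut_map_Bij:
  assumes "\<alpha> \<in> graph_auts X E"
  shows "aut_map \<alpha> \<in> Bij (carrier S)"
proof -
  interpret A: group "graph_aut_group X E"
    by (rule group_graph_aut_group)
  define \<beta> where "\<beta> = inv\<^bsub>graph_aut_group X E\<^esub> \<alpha>"
  have b: "\<beta> \<in> graph_auts X E"
    using A.inv_closed[of \<alpha>] assms by (simp add: \<beta>_def)
  have "compose X \<alpha> \<beta> = (\<lambda>x\<in>X. x)" "compose X \<beta> \<alpha> = (\<lambda>x\<in>X. x)"
    using A.r_inv[of \<alpha>] A.l_inv[of \<alpha>] assms b by (simp_all add: mult_graph_aut_group flip: \<beta>_def)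
  then have "\<alpha> (\<beta> x) = x" "\<beta> (\<alpha> x) = x" if "x \<in> X" for x
    using that by (metis compose_eq restrict_apply')+
  then show ?thesis
    unfolding aut_map_def
    by (intro induced_Bij[OF respectful_map[OF assms] respectful_map[OF b]])
      (auto intro!: map_idI)
qed

lemma aut_map_hom: "aut_map \<in> hom (graph_aut_group X E) (BijGroup (carrier S))"
  by (rule homI) (simp_all add: aut_map_Bij mult_graph_aut_group aut_map_compose,
      simp_all add: BijGroup_def aut_map_Bij)

text \<open>The value of an automorphism at a vertex is recovered from the action of its induced map
  on one-letter classes.\<close>

lemma aut_map_inj: "inj_on aut_map (graph_auts X E)"
proof (rule inj_onI)
  fix \<alpha> \<beta> assume ab: "\<alpha> \<in> graph_auts X E" "\<beta> \<in> graph_auts X E" and eq: "aut_map \<alpha> = aut_map \<beta>"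
  show "\<alpha> = \<beta>"
  proof (rule extensionalityI[of _ X])
    fix x assume x: "x \<in> X"
    then have "cls [\<alpha> x] = cls [\<beta> x]"
      using ab eq aut_map_cls[of \<alpha> "[x]"] aut_map_cls[of \<beta> "[x]"] by simp
    then show "\<alpha> x = \<beta> x"
      using x ab by (simp add: cls_singleton_iff graph_autsD(2))
  qed (use ab graph_autsD(1) Bij_imp_extensional in blast)+
qed

sublocale aut_map: group_hom "graph_aut_group X E" "BijGroup (carrier S)" aut_map
  by (intro group_hom.intro group_hom_axioms.intro group_graph_aut_group group_BijGroup aut_map_hom)

lemma reversal_reversal: "compose (carrier S) reversal reversal = (\<lambda>A\<in>carrier S. A)"
  unfolding reversal_def compose_induced[OF respectful_rev respectful_rev]
  by (rule induced_idI[OF respectful_comp[OF respectful_rev respectful_rev]]) simp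

text \<open>Reversal rearranges positions while \<open>map \<alpha>\<close> acts on each letter
  separately, so the two commute already on words.\<close>

lemma reversal_aut_map:
  assumes "\<alpha> \<in> graph_auts X E"
  shows "compose (carrier S) (aut_map \<alpha>) reversal = compose (carrier S) reversal (aut_map \<alpha>)"
  unfolding reversal_def aut_map_def compose_induced[OF respectful_map[OF assms] respectful_rev]
    compose_induced[OF respectful_rev respectful_map[OF assms]]
  by (rule induced_eqI) (use assms in \<open>simp_all add: respectful_comp respectful_rev respectful_map rev_map\<close>)


subsection \<open>Involutions\<close>

text \<open>Letters are irreducible. If the image of a letter were a product, applying
  \<open>\<phi>\<close> once more would write the letter itself as a product of two non-empty
  words.\<close>

lemma involution_maps_generators:
  assumes bij: "\<phi> \<in> Bij (carrier S)"
    and anti: "\<And>A B. \<lbrakk>A \<in> carrier S; B \<in> carrier S\<rbrakk> \<Longrightarrow> \<phi> (A \<cdot>\<^bsub>S\<^esub> B) = \<phi> B \<cdot>\<^bsub>S\<^esub> \<phi> A"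
    and invol: "\<And>A. A \<in> carrier S \<Longrightarrow> \<phi> (\<phi> A) = A"
    and x: "x \<in> X"
  obtains y where "y \<in> X" "\<phi> (cls [x]) = cls [y]"
proof -
  have \<phi>S: "\<phi> A \<in> carrier S" if "A \<in> carrier S" for A
    using Bij_imp_funcset[OF bij] that by blast
  have xS: "cls [x] \<in> carrier S"
    using x by (simp add: cls_in_S)
  obtain u where u: "u \<in> F" "\<phi> (cls [x]) = cls u"
    using \<phi>S[OF xS] by (auto simp: carrier_S)
  obtain y w where yw: "u = y # w"
    using u by (cases u) auto
  have "w = []"
  proof (rule ccontr)
    assume "w \<noteq> []"
    then have yw': "[y] \<in> F" "w \<in> F"
      using u yw by auto
    obtain a b where ab: "a \<in> F" "b \<in> F" "\<phi> (cls [y]) = cls a" "\<phi> (cls w) = cls b"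
      using \<phi>S[OF cls_in_S[OF yw'(1)]] \<phi>S[OF cls_in_S[OF yw'(2)]] by (auto simp: carrier_S)
    have "cls [x] = \<phi> (cls u)"
      using invol[OF xS] u by simp
    also have "cls u = cls [y] \<cdot>\<^bsub>S\<^esub> cls w"
      using cls_mult[OF yw'] yw by simp
    also have "\<phi> \<dots> = cls b \<cdot>\<^bsub>S\<^esub> cls a"
      using anti cls_in_S yw' ab by simp
    also have "\<dots> = cls (b @ a)"
      using ab by (simp only: cls_mult)
    finally have "b @ a = [x]"
      using x ab by (simp add: cls_singleton_iff)
    then show False
      using ab by (auto simp: append_eq_Cons_conv)
  qed
  then show thesis
    using that u yw by simp
qed

text \<open>An anti-homomorphism is determined by its values on letters: peeling off the first
  letter of a word moves its image to the end.\<close>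

lemma anti_hom_eqI:
  assumes anti: "\<And>A B. \<lbrakk>A \<in> carrier S; B \<in> carrier S\<rbrakk> \<Longrightarrow> \<phi> (A \<cdot>\<^bsub>S\<^esub> B) = \<phi> B \<cdot>\<^bsub>S\<^esub> \<phi> A"
    and \<alpha>: "\<And>x. x \<in> X \<Longrightarrow> \<alpha> x \<in> X" "\<And>x. x \<in> X \<Longrightarrow> \<phi> (cls [x]) = cls [\<alpha> x]"
    and u: "u \<in> F"
  shows "\<phi> (cls u) = cls (rev (map \<alpha> u))"
  using u
proof (induction u)
  case (Cons x w)
  show ?case
  \<comment> \<open>The empty word represents no element of the semigroup, so the word can be split
    into \<open>[x]\<close> and \<open>w\<close> only for non-empty \<open>w\<close>.\<close>
  proof (cases "w = []")
    case True
    then show ?thesis using Cons.prems \<alpha> by simp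
  next
    case False
    then have xw: "[x] \<in> F" "w \<in> F" "rev (map \<alpha> w) \<in> F" "[\<alpha> x] \<in> F" "x \<in> X"
      using Cons.prems \<alpha> by auto
    have "\<phi> (cls (x # w)) = \<phi> (cls [x] \<cdot>\<^bsub>S\<^esub> cls w)"
      using cls_mult[OF xw(1,2)] by simp
    also have "\<dots> = cls (rev (map \<alpha> w)) \<cdot>\<^bsub>S\<^esub> cls [\<alpha> x]"
      using anti[OF cls_in_S[OF xw(1)] cls_in_S[OF xw(2)]] Cons.IH[OF xw(2)] \<alpha>(2)[OF xw(5)]
      by simp
    also have "\<dots> = cls (rev (map \<alpha> (x # w)))"
      using cls_mult[OF xw(3,4)] by simp
    finally show ?thesis .
  qed
qed simp

text \<open>The action on letters gives \<open>\<alpha>\<close>, and commutation of letters encodes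
  adjacency. The parameter \<open>\<alpha>\<close> may be the identity; the identity of
  \<open>S\<close> is removed because an involution is non-trivial by definition.\<close>

lemma involutions_S:
  "involutions S =
    (\<lambda>\<alpha>. compose (carrier S) reversal (aut_map \<alpha>)) `
      {\<alpha> \<in> graph_auts X E. compose X \<alpha> \<alpha> = (\<lambda>x\<in>X. x)} - {\<lambda>A\<in>carrier S. A}"
  (is "_ = ?T ` ?I - _")
proof (intro equalityI subsetI)
  fix \<phi> assume "\<phi> \<in> involutions S"
  then have bij: "\<phi> \<in> Bij (carrier S)" and ne: "\<phi> \<noteq> (\<lambda>A\<in>carrier S. A)"
    and anti: "\<And>A B. \<lbrakk>A \<in> carrier S; B \<in> carrier S\<rbrakk> \<Longrightarrow> \<phi> (A \<cdot>\<^bsub>S\<^esub> B) = \<phi> B \<cdot>\<^bsub>S\<^esub> \<phi> A"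
    and comp: "compose (carrier S) \<phi> \<phi> = (\<lambda>A\<in>carrier S. A)"
    by (simp_all add: involutions_def)
  have invol: "\<phi> (\<phi> A) = A" if "A \<in> carrier S" for A
    using comp that by (metis compose_eq restrict_apply')
  define \<alpha> where "\<alpha> = (\<lambda>x\<in>X. SOME y. y \<in> X \<and> \<phi> (cls [x]) = cls [y])"
  have "\<alpha> x \<in> X \<and> \<phi> (cls [x]) = cls [\<alpha> x]" if x: "x \<in> X" for x
  proof -
    have "\<exists>y. y \<in> X \<and> \<phi> (cls [x]) = cls [y]"
      using involution_maps_generators[OF bij anti invol x] by metis
    from someI_ex[OF this] show ?thesis
      using x by (simp add: \<alpha>_def)
  qed
  then have \<alpha>: "\<And>x. x \<in> X \<Longrightarrow> \<alpha> x \<in> X" "\<And>x. x \<in> X \<Longrightarrow> \<phi> (cls [x]) = cls [\<alpha> x]"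
    by blast+
  have \<phi>: "\<phi> (cls u) = cls (rev (map \<alpha> u))" if "u \<in> F" for u
    using anti \<alpha> that by (rule anti_hom_eqI)
  have \<alpha>\<alpha>: "\<alpha> (\<alpha> x) = x" if "x \<in> X" for x
  proof -
    have "cls [x] = cls [\<alpha> (\<alpha> x)]"
      using invol[of "cls [x]"] that \<alpha> cls_in_S[of "[x]"] by simp
    then show ?thesis
      using that \<alpha>(1) by (simp add: cls_singleton_iff)
  qed
  have \<alpha>_ext: "\<alpha> \<in> extensional X"
    unfolding \<alpha>_def by (rule restrict_extensional)
  have \<alpha>_bij: "\<alpha> \<in> Bij X" "compose X \<alpha> \<alpha> = (\<lambda>x\<in>X. x)"
    using Bij_involI[OF _ \<alpha>(1) \<alpha>\<alpha>] \<alpha>_ext by blast+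
  \<comment> \<open>Adjacent letters commute, so their images under \<open>\<phi>\<close> commute as
    well; these are distinct letters, and hence adjacent.\<close>
  have edge: "{\<alpha> x, \<alpha> y} \<in> E" if "{x, y} \<in> E" for x y
  proof -
    have xy: "x \<in> X" "y \<in> X" "x \<noteq> y"
      using edgeD[OF that] by auto
    have "\<phi> (cls [x, y]) = \<phi> (cls [y, x])"
      using cls_edge[OF that] by simp
    then have "cls [\<alpha> x, \<alpha> y] = cls [\<alpha> y, \<alpha> x]"
      using \<phi>[of "[x, y]"] \<phi>[of "[y, x]"] xy by simp
    moreover have "\<alpha> x \<noteq> \<alpha> y"
      using \<alpha>\<alpha>[OF xy(1)] \<alpha>\<alpha>[OF xy(2)] xy(3) by metis
    ultimately show ?thesis
      using xy \<alpha>(1) by (simp add: cls_commute_iff)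
  qed
  \<comment> \<open>The converse is \<open>edge\<close> applied to \<open>\<alpha> x\<close> and
    \<open>\<alpha> y\<close>, since \<open>\<alpha>\<close> is its own inverse.\<close>
  have "{\<alpha> x, \<alpha> y} \<in> E \<longleftrightarrow> {x, y} \<in> E" if "x \<in> X" "y \<in> X" for x y
    using edge[of x y] edge[of "\<alpha> x" "\<alpha> y"] \<alpha>\<alpha> that by auto
  then have \<alpha>I: "\<alpha> \<in> ?I"
    using \<alpha>_bij by (simp add: graph_auts_def)
  have "\<phi> = ?T \<alpha>"
  proof (rule extensional_S_eqI)
    fix u assume u: "u \<in> F"
    have "map \<alpha> u \<in> F"
      using u \<alpha>(1) by auto
    then show "\<phi> (cls u) = ?T \<alpha> (cls u)"
      using \<phi>[OF u] \<alpha>I u aut_map_cls[OF _ u, of \<alpha>] reversal_cls[of "map \<alpha> u"]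
      by (simp add: compose_eq cls_in_S)
  qed (use bij Bij_imp_extensional in auto)
  then show "\<phi> \<in> ?T ` ?I - {\<lambda>A\<in>carrier S. A}"
    using ne \<alpha>I by blast
next
  fix \<phi> assume "\<phi> \<in> ?T ` ?I - {\<lambda>A\<in>carrier S. A}"
  then obtain \<alpha> where \<alpha>: "\<alpha> \<in> graph_auts X E" "compose X \<alpha> \<alpha> = (\<lambda>x\<in>X. x)"
    and \<phi>: "\<phi> = ?T \<alpha>" "\<phi> \<noteq> (\<lambda>A\<in>carrier S. A)"
    by blast
  have F: "map \<alpha> u \<in> F" if "u \<in> F" for u
    using that graph_autsD(2)[OF \<alpha>(1)] by auto
  have \<phi>_cls: "\<phi> (cls u) = cls (rev (map \<alpha> u))" if "u \<in> F" for u
    using reversal_cls[OF F[OF that]] that \<alpha>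
    by (simp add: \<phi> compose_eq cls_in_S aut_map_cls)
  have bij: "\<phi> \<in> Bij (carrier S)"
    unfolding \<phi> using \<alpha> by (intro compose_Bij reversal_Bij aut_map_Bij)
  have anti: "\<phi> (A \<cdot>\<^bsub>S\<^esub> B) = \<phi> B \<cdot>\<^bsub>S\<^esub> \<phi> A" if AB: "A \<in> carrier S" "B \<in> carrier S" for A B
  proof -
    obtain u v where uv: "u \<in> F" "v \<in> F" "A = cls u" "B = cls v"
      using AB by (auto simp only: carrier_S)
    have "rev (map \<alpha> u) \<in> F" "rev (map \<alpha> v) \<in> F" "u @ v \<in> F"
      using F uv by simp_all
    then show ?thesis
      using uv by (simp only: \<phi>_cls cls_mult) simp
  qed
  have "\<alpha> (\<alpha> x) = x" if "x \<in> X" for x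
    using \<alpha>(2) that by (metis compose_eq restrict_apply')
  then have mm: "map \<alpha> (map \<alpha> u) = u" if "u \<in> F" for u
    using that by (auto intro!: map_idI)
  have "compose (carrier S) \<phi> \<phi> = (\<lambda>A\<in>carrier S. A)"
  proof (rule extensional_S_eqI)
    fix u assume u: "u \<in> F"
    have "\<phi> (\<phi> (cls u)) = cls (rev (map \<alpha> (rev (map \<alpha> u))))"
      using \<phi>_cls[OF u] \<phi>_cls[of "rev (map \<alpha> u)"] F[OF u] by simp
    also have "\<dots> = cls u"
      using mm[OF u] by (simp add: rev_map del: map_map)
    finally show "compose (carrier S) \<phi> \<phi> (cls u) = (\<lambda>A\<in>carrier S. A) (cls u)"
      using u by (simp add: compose_eq cls_in_S)
  qed simp_all
  with bij anti \<phi>(2) show "\<phi> \<in> involutions S"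
    by (simp add: involutions_def)
qed

section \<open>The complete and the non-complete case\<close>

lemma graph_involutions_subset: "graph_involutions X E \<subseteq> graph_auts X E"
  by (auto simp: graph_involutions_def)

text \<open>This brings the index set of \<open>involutions_S\<close> into the form
  \<open>insert \<one> I\<close> used for the twisted generators.\<close>

lemma insert_id_graph_involutions:
  "{\<alpha> \<in> graph_auts X E. compose X \<alpha> \<alpha> = (\<lambda>x\<in>X. x)} = insert (\<lambda>x\<in>X. x) (graph_involutions X E)"
  using id_graph_auts by (auto simp: graph_involutions_def)

text \<open>Adjacency in the complete graph is distinctness, which every injective map preserves and
  reflects.\<close>

lemma graph_auts_complete:
  assumes "E = complete_edges X"
  shows "graph_auts X E = Bij X"
proof -
  have "{\<alpha> x, \<alpha> y} \<in> E \<longleftrightarrow> {x, y} \<in> E" if "\<alpha> \<in> Bij X" "x \<in> X" "y \<in> X" for \<alpha> x y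
  proof -
    have "{a, b} \<in> E \<longleftrightarrow> a \<noteq> b" if "a \<in> X" "b \<in> X" for a b
      using that assms by (auto simp: complete_edges_def doubleton_eq_iff)
    moreover have "\<alpha> x = \<alpha> y \<longleftrightarrow> x = y"
      using that by (auto simp: Bij_def bij_betw_def inj_on_eq_iff)
    moreover have "\<alpha> x \<in> X" "\<alpha> y \<in> X"
      using that Bij_imp_funcset by blast+
    ultimately show ?thesis
      using that by simp
  qed
  then show ?thesis
    by (auto simp: graph_auts_def)
qed

text \<open>All letters commute, so a letter can be moved across a whole word; doing this for each
  letter in turn reverses the word within its class.\<close>

lemma reversal_complete:
  assumes "E = complete_edges X"
  shows "reversal = (\<lambda>A\<in>carrier S. A)"
proof (rule extensional_S_eqI)
  have comm: "cls (x # w) = cls (w @ [x])" if "x \<in> X" "set w \<subseteq> X" for x w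
    using that(2)
  proof (induction w)
    case (Cons y w)
    have xy: "cls [x, y] = cls [y, x]"
      using Cons.prems that assms
      by (subst cls_commute_iff) (auto simp: complete_edges_def)
    show ?case
    proof (cases "w = []")
      case False
      then have "cls (x # y # w) = cls [x, y] \<cdot>\<^bsub>S\<^esub> cls w"
        using cls_mult[of "[x, y]" w] Cons.prems that by simp
      also have "\<dots> = cls [y] \<cdot>\<^bsub>S\<^esub> cls (x # w)"
        using xy cls_mult[of "[y, x]" w] cls_mult[of "[y]" "x # w"] Cons.prems that False by simp
      also have "\<dots> = cls ((y # w) @ [x])"
        using Cons cls_mult[of "[y]" "w @ [x]"] that by simp
      finally show ?thesis .
    qed (simp add: xy)
  qed simp
  have "cls (rev u) = cls u" if "u \<in> F" for u
    using that
  proof (induction u)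
    case (Cons x w)
    show ?case
    proof (cases "w = []")
      case False
      then have "cls (rev (x # w)) = cls (rev w) \<cdot>\<^bsub>S\<^esub> cls [x]"
        using cls_mult[of "rev w" "[x]"] Cons.prems by simp
      also have "\<dots> = cls (w @ [x])"
        using cls_mult[of "w" "[x]"] Cons False by simp
      finally show ?thesis
        using comm[of x w] Cons.prems by simp
    qed simp
  qed simp
  then show "reversal (cls u) = (\<lambda>A\<in>carrier S. A) (cls u)" if "u \<in> F" for u
    using that reversal_cls[OF that] by (simp add: cls_in_S)
qed (simp_all add: reversal_def induced_extensional)

text \<open>Reversal fixes all letters, so an automorphism inducing it would be the identity on
  vertices. But reversal exchanges the distinct classes of \<open>[x, y]\<close> and
  \<open>[y, x]\<close> for distinct non-adjacent \<open>x\<close> and \<open>y\<close>.\<close>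

lemma reversal_noncomplete:
  assumes "E \<noteq> complete_edges X"
  shows "reversal \<notin> aut_map ` graph_auts X E"
proof
  assume "reversal \<in> aut_map ` graph_auts X E"
  then obtain \<alpha> where \<alpha>: "\<alpha> \<in> graph_auts X E" and eq: "reversal = aut_map \<alpha>"
    by blast
  have id: "\<alpha> x = x" if "x \<in> X" for x
    using reversal_cls[of "[x]"] aut_map_cls[OF \<alpha>, of "[x]"] that eq graph_autsD(2)[OF \<alpha> that]
    by (simp add: cls_singleton_iff)
  obtain x y where xy: "x \<in> X" "y \<in> X" "x \<noteq> y" "{x, y} \<notin> E"
    using assms graph by (auto simp: simple_graph_def complete_edges_def)
  then have "cls [x, y] = cls [y, x]"
    using reversal_cls[of "[x, y]"] aut_map_cls[OF \<alpha>, of "[x, y]"] id eq by simp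
  then show False
    using xy by (simp add: cls_commute_iff)
qed

text \<open>As reversal is trivial, the involutions of \<open>S\<close> are exactly the maps induced
  by graph involutions. These generate a copy of all of \<open>BijGroup X\<close>, because every
  permutation is a product of two self-inverse ones.\<close>

lemma involution_group_complete:
  assumes "E = complete_edges X"
  shows "involution_group S \<cong> BijGroup X"
proof -
  let ?A = "graph_aut_group X E" and ?I = "graph_involutions X E"
  have A: "?A = BijGroup X"
    unfolding graph_aut_group_def graph_auts_complete[OF assms] by (simp add: BijGroup_def)
  \<comment> \<open>By injectivity only the identity automorphism induces the identity, so removing
    the identity of \<open>S\<close> leaves exactly the image of the graph involutions.\<close>
  have one: "aut_map \<alpha> \<noteq> (\<lambda>A\<in>carrier S. A)" if "\<alpha> \<in> ?I" for \<alpha>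
    using that aut_map_inj id_graph_auts
    by (auto simp: graph_involutions_def inj_on_eq_iff simp flip: aut_map_id)
  have "involutions S = aut_map ` ?I"
  proof -
    have "compose (carrier S) reversal (aut_map \<alpha>) = aut_map \<alpha>" if "\<alpha> \<in> graph_auts X E" for \<alpha>
      unfolding reversal_complete[OF assms] using aut_map_Bij[OF that]
      by (simp add: Bij_imp_funcset Bij_imp_extensional)
    then have "involutions S = aut_map ` insert (\<lambda>x\<in>X. x) ?I - {\<lambda>A\<in>carrier S. A}"
      unfolding involutions_S insert_id_graph_involutions
      using id_graph_auts graph_involutions_subset by (intro arg_cong2[where f = minus] image_cong) auto
    then show ?thesis
      using one by (auto simp: aut_map_id)
  qed
  then have "involution_group S \<cong> subgroup_generated ?A ?I"
    unfolding involution_group_def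
    using aut_map.subgroup_generated_image_iso[of ?I] aut_map_inj graph_involutions_subset by simp
  moreover have "generate ?A ?I = graph_auts X E"
  proof
    show "generate ?A ?I \<subseteq> graph_auts X E"
      using aut_map.G.generate_incl[of ?I] graph_involutions_subset by simp
    \<comment> \<open>A self-inverse permutation is either the identity, which lies in every
      generated subgroup, or a graph involution.\<close>
    have inv: "s \<in> generate ?A ?I" if "s \<in> Bij X" "compose X s s = (\<lambda>x\<in>X. x)" for s
    proof -
      have "s \<in> insert \<one>\<^bsub>?A\<^esub> ?I"
        using that insert_id_graph_involutions by (auto simp: graph_auts_complete[OF assms])
      then show ?thesis
        by (elim insertE) (auto simp only: intro: generate.one generate.incl)
    qed
    show "graph_auts X E \<subseteq> generate ?A ?I"
    proof
      fix f assume "f \<in> graph_auts X E"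
      then have "f \<in> Bij X"
        by (rule graph_autsD(1))
      then obtain s t where st: "s \<in> Bij X" "compose X s s = (\<lambda>x\<in>X. x)"
        "t \<in> Bij X" "compose X t t = (\<lambda>x\<in>X. x)" "f = compose X t s"
        by (rule Bij_product_of_two_involutions)
      then have "t \<otimes>\<^bsub>?A\<^esub> s \<in> generate ?A ?I"
        by (intro generate.eng inv)
      then show "f \<in> generate ?A ?I"
        using st by (simp add: mult_graph_aut_group graph_auts_complete[OF assms])
    qed
  qed
  then have "subgroup_generated ?A ?I = BijGroup X"
    using graph_involutions_subset
    by (simp add: subgroup_generated_def Int_absorb1) (simp add: A flip: carrier_graph_aut_group)
  ultimately show ?thesis
    by simp
qed

text \<open>Reversal plays the role of \<open>r\<close> for the homomorphism \<open>aut_map\<close>.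
  The identity automorphism now yields reversal itself, a genuine involution, so it accounts for the
  inserted \<open>\<one>\<close>.\<close>

lemma involution_group_noncomplete:
  assumes "E \<noteq> complete_edges X"
  shows "involution_group S \<cong> integer_mod_group 2 \<times>\<times> graph_involution_group X E"
proof -
  let ?A = "graph_aut_group X E" and ?I = "graph_involutions X E"
  let ?B = "BijGroup (carrier S)"
  have B: "reversal \<in> carrier ?B"
    using reversal_Bij by (simp add: BijGroup_def)
  have mult: "f \<otimes>\<^bsub>?B\<^esub> g = compose (carrier S) f g"
    if "f \<in> Bij (carrier S)" "g \<in> Bij (carrier S)" for f g
    using that by (simp add: BijGroup_def)
  have "reversal \<otimes>\<^bsub>?B\<^esub> reversal = \<one>\<^bsub>?B\<^esub>"
    by (simp add: mult reversal_Bij reversal_reversal) (simp add: BijGroup_def)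
  then have iso: "subgroup_generated ?B ((\<lambda>\<alpha>. reversal \<otimes>\<^bsub>?B\<^esub> aut_map \<alpha>) ` insert \<one>\<^bsub>?A\<^esub> ?I)
      \<cong> integer_mod_group 2 \<times>\<times> subgroup_generated ?A ?I"
    using aut_map_inj graph_involutions_subset B reversal_noncomplete[OF assms]
    by (intro aut_map.subgroup_generated_twisted_image_iso)
      (simp_all add: mult reversal_Bij aut_map_Bij reversal_aut_map)
  \<comment> \<open>If reversal composed with the map of \<open>\<alpha>\<close> were the identity,
    cancelling against \<open>\<alpha>\<alpha> = 1\<close> would make reversal equal to the map
    induced by \<open>\<alpha>\<close>. So the set difference in \<open>involutions_S\<close>
    removes nothing.\<close>
  have ne: "compose (carrier S) reversal (aut_map \<alpha>) \<noteq> (\<lambda>A\<in>carrier S. A)"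
    if \<alpha>: "\<alpha> \<in> graph_auts X E" "compose X \<alpha> \<alpha> = (\<lambda>x\<in>X. x)" for \<alpha>
  proof
    assume "compose (carrier S) reversal (aut_map \<alpha>) = (\<lambda>A\<in>carrier S. A)"
    then have "reversal \<otimes>\<^bsub>?B\<^esub> aut_map \<alpha> = aut_map \<alpha> \<otimes>\<^bsub>?B\<^esub> aut_map \<alpha>"
      using \<alpha> by (simp add: mult reversal_Bij aut_map_Bij aut_map_id flip: aut_map_compose)
    then have "reversal = aut_map \<alpha>"
      using B aut_map.H.right_cancel[of "aut_map \<alpha>" reversal "aut_map \<alpha>"] \<alpha> aut_map.hom_closed by simp
    then show False
      using reversal_noncomplete[OF assms] \<alpha> by blast
  qed
  have "(\<lambda>A\<in>carrier S. A) \<notin> (\<lambda>\<alpha>. compose (carrier S) reversal (aut_map \<alpha>)) `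
      {\<alpha> \<in> graph_auts X E. compose X \<alpha> \<alpha> = (\<lambda>x\<in>X. x)}"
  proof
    assume "(\<lambda>A\<in>carrier S. A) \<in> (\<lambda>\<alpha>. compose (carrier S) reversal (aut_map \<alpha>)) `
      {\<alpha> \<in> graph_auts X E. compose X \<alpha> \<alpha> = (\<lambda>x\<in>X. x)}"
    then obtain \<alpha> where "\<alpha> \<in> graph_auts X E" "compose X \<alpha> \<alpha> = (\<lambda>x\<in>X. x)"
      "(\<lambda>A\<in>carrier S. A) = compose (carrier S) reversal (aut_map \<alpha>)"
      by (elim imageE CollectE conjE)
    from ne[OF this(1,2)] this(3) show False
      by (rule notE[OF _ sym])
  qed
  then have "involutions S =
      (\<lambda>\<alpha>. compose (carrier S) reversal (aut_map \<alpha>)) ` insert \<one>\<^bsub>?A\<^esub> ?I"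
    unfolding involutions_S one_graph_aut_group insert_id_graph_involutions
    by (rule Diff_insert0[THEN trans]) (rule Diff_empty)
  also have "\<dots> = (\<lambda>\<alpha>. reversal \<otimes>\<^bsub>?B\<^esub> aut_map \<alpha>) ` insert \<one>\<^bsub>?A\<^esub> ?I"
    using graph_involutions_subset id_graph_auts
    by (intro image_cong) (auto simp: mult reversal_Bij aut_map_Bij)
  finally show ?thesis
    using iso by (simp add: involution_group_def graph_involution_group_def)
qed

end

theorem theorem4p4:
  fixes X :: "'a set" and E :: "'a set set"
  assumes "simple_graph X E"
  shows "(E = complete_edges X \<longrightarrow>
            involution_group (graph_sgrp X E) \<cong> BijGroup X) \<and>
         (E \<noteq> complete_edges X \<longrightarrow>
            involution_group (graph_sgrp X E) \<cong>
              integer_mod_group 2 \<times>\<times> graph_involution_group X E)"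
proof -
  interpret graph_semigroup X E
    using assms by unfold_locales
  show ?thesis
    using involution_group_complete involution_group_noncomplete by blast
qed

end
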